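(* Let $n,k$ be natural numbers with $n\ge2$ and let $\mathcal{A}\subseteq[k]^n$ be a transitive-symmetric vector-intersecting family. If $2\log n\le k\le\sqrt n\log n$, then $\frac{|\mathcal{A}|}{k^n}\le128\exp\left(-\frac{0.0001k}{\log n}\right)$. If $k>\sqrt n\log n$, then $\frac{|\mathcal{A}|}{k^n}\le128\exp(-0.0001\sqrt n)$.
   Context: $\log$ natural. $\mathcal{A}\subseteq[k]^n$ is vector-intersecting if for all $x,y\in\mathcal{A}$ there is $i\in[n]$ with $x_i=y_i$. It is transitive-symmetric if for all $i,j\in[n]$ there is a permutation $\sigma$ of $[n]$ with $\sigma(i)=j$ such that $(x_1,\dots,x_n)\in\mathcal{A}\iff(x_{\sigma(1)},\dots,x_{\sigma(n)})\in\mathcal{A}$. *)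

theory Defs
  imports Complex_Main "HOL-Library.FuncSet" "HOL-Combinatorics.Permutations"
begin

definition cube :: "nat \<Rightarrow> nat \<Rightarrow> (nat \<Rightarrow> nat) set" where
  "cube k n = {0..<n} \<rightarrow>\<^sub>E {0..<k}"

definition vector_intersecting :: "nat \<Rightarrow> (nat \<Rightarrow> nat) set \<Rightarrow> bool" where
  "vector_intersecting n A \<longleftrightarrow> (\<forall>x\<in>A. \<forall>y\<in>A. \<exists>i\<in>{0..<n}. x i = y i)"

definition transitive_symmetric :: "nat \<Rightarrow> (nat \<Rightarrow> nat) set \<Rightarrow> bool" where
  "transitive_symmetric n A \<longleftrightarrow>
     (\<forall>i\<in>{0..<n}. \<forall>j\<in>{0..<n}. \<exists>\<sigma>. \<sigma> permutes {0..<n} \<and> \<sigma> i = j \<and>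
        (\<forall>x \<in> {0..<n} \<rightarrow>\<^sub>E (UNIV::nat set). x \<in> A \<longleftrightarrow> x \<circ> \<sigma> \<in> A))"

end

(*
Encode a vector as its graph in [n] x [k]. Call a family rho-spread if at most a fraction
rho^|U| of its members contain any given set U. Fix values on a maximal set T of coordinates
keeping at least a fraction rho^|T| of A, with rho = 4/k: by maximality the restricted family
is rho-spread on the other coordinates, and 4^|T| <= k^n/|A|. If A were too large, then
|T|^2 < n, so averaging over the symmetry group gives an automorphism sigma with sigma(T)
disjoint from T. This yields two spread families in A, fixed on disjoint sets of
coordinates; discarding the few vectors of each that agree with the values fixed in the
other keeps them spread. A random half of [n] x [k] contains a member of a spread family of
almost full mass with probability > 1/2, hence some half contains a member of the first
family and its complement one of the second: two vectors of A that agree nowhere.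

The containment probability is bounded by adding about log_2 n independent sparse random
sets W, each halving the size of what remains to be covered. For one step, x is uncovered by
W exactly when no x' in W + x has a small remainder x' - W. Given Z = W + x, every member x'
of Z satisfies x' - W <= x' /\ x, so failure means that all members of Z meet x in a large
set, which spreadness makes unlikely.
*)
theory Submission
  imports Defs
begin

section \<open>Expectation over random subsets\<close>

text \<open>The mean of \<open>f\<close> at a random subset of the finite set \<open>V\<close> that
  contains each point independently with probability \<open>p\<close>.\<close>

definition bexp :: "real \<Rightarrow> 'a set \<Rightarrow> ('a set \<Rightarrow> real) \<Rightarrow> real" where
  "bexp p V f = (\<Sum>S\<in>Pow V. p ^ card S * (1 - p) ^ card (V - S) * f S)"

lemma bexp_empty [simp]: "bexp p {} f = f {}"
  by (simp add: bexp_def)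

lemma bexp_insert:
  assumes "finite V" "v \<notin> V"
  shows "bexp p (insert v V) f = (1 - p) * bexp p V f + p * bexp p V (\<lambda>S. f (insert v S))"
proof -
  have inj: "inj_on (insert v) (Pow V)"
    using assms(2) by (auto simp: inj_on_def)
  have disj: "Pow V \<inter> insert v ` Pow V = {}"
    using assms(2) by auto
  let ?g = "\<lambda>S. p ^ card S * (1 - p) ^ card (insert v V - S) * f S"
  have 1: "?g S = (1 - p) * (p ^ card S * (1 - p) ^ card (V - S) * f S)" if "S \<in> Pow V" for S
  proof -
    have "insert v V - S = insert v (V - S)" "v \<notin> V - S" "finite (V - S)"
      using that assms by auto
    then show ?thesis by simp
  qed
  have 2: "?g (insert v S) = p * (p ^ card S * (1 - p) ^ card (V - S) * f (insert v S))"
    if "S \<in> Pow V" for S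
  proof -
    have "insert v V - insert v S = V - S" "v \<notin> S" "finite S"
      using that assms finite_subset by auto
    then show ?thesis by simp
  qed
  have "bexp p (insert v V) f = sum ?g (Pow V \<union> insert v ` Pow V)"
    unfolding bexp_def by (simp add: Pow_insert)
  also have "\<dots> = sum ?g (Pow V) + sum ?g (insert v ` Pow V)"
    using assms(1) disj by (intro sum.union_disjoint) auto
  also have "sum ?g (Pow V) = (1 - p) * bexp p V f"
    unfolding bexp_def sum_distrib_left by (rule sum.cong[OF refl 1])
  also have "sum ?g (insert v ` Pow V) = (\<Sum>S\<in>Pow V. ?g (insert v S))"
    by (subst sum.reindex[OF inj]) simp
  also have "\<dots> = p * bexp p V (\<lambda>S. f (insert v S))"
    unfolding bexp_def sum_distrib_left by (rule sum.cong[OF refl 2])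
  finally show ?thesis .
qed

lemma bexp_mono:
  assumes "0 \<le> p" "p \<le> 1" "\<And>S. S \<subseteq> V \<Longrightarrow> f S \<le> g S"
  shows "bexp p V f \<le> bexp p V g"
  unfolding bexp_def using assms by (intro sum_mono mult_left_mono) auto

lemma bexp_add: "bexp p V (\<lambda>S. f S + g S) = bexp p V f + bexp p V g"
  by (simp add: bexp_def algebra_simps sum.distrib)

lemma bexp_cmult: "bexp p V (\<lambda>S. c * f S) = c * bexp p V f"
  by (simp add: bexp_def sum_distrib_left algebra_simps)

lemma bexp_sum: "bexp p V (\<lambda>S. \<Sum>i\<in>X. f i S) = (\<Sum>i\<in>X. bexp p V (f i))"
  unfolding bexp_def sum_distrib_left by (rule sum.swap)

lemma bexp_const [simp]: "finite V \<Longrightarrow> bexp p V (\<lambda>S. c) = c"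
  by (induction V rule: finite_induct) (simp_all add: bexp_insert algebra_simps)

text \<open>A point is missed by both of two independent sets with probability
  \<open>(1 - p) * (1 - q)\<close>.\<close>

lemma bexp_bexp_union:
  assumes "finite V"
  shows "bexp p V (\<lambda>W. bexp q V (\<lambda>S. f (W \<union> S))) = bexp (1 - (1 - p) * (1 - q)) V f"
  using assms
proof (induction V arbitrary: f rule: finite_induct)
  case empty
  show ?case by simp
next
  case (insert v V)
  let ?r = "1 - (1 - p) * (1 - q)"
  let ?f = "\<lambda>S. f (insert v S)"
  show ?case
    using insert.IH[of f] insert.IH[of ?f] insert.hyps
    by (simp add: bexp_insert bexp_add bexp_cmult insert_commute) (simp add: algebra_simps)
qed

text \<open>Conditioned on containing \<open>Y\<close>, a random set is distributed as
  \<open>W \<union> Y\<close> with \<open>W\<close> random.\<close>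

lemma bexp_superset:
  assumes "finite V" "Y \<subseteq> V"
  shows "bexp p V (\<lambda>Z. of_bool (Y \<subseteq> Z) * f Z) = p ^ card Y * bexp p V (\<lambda>W. f (W \<union> Y))"
  using assms
proof (induction V arbitrary: f Y rule: finite_induct)
  case empty
  then show ?case by simp
next
  case (insert v V)
  show ?case
  proof (cases "v \<in> Y")
    case False
    then have Y: "Y \<subseteq> V" using insert.prems by auto
    have "Y \<subseteq> insert v S \<longleftrightarrow> Y \<subseteq> S" for S using False by auto
    then show ?thesis
      using insert.IH[OF Y, of f] insert.IH[OF Y, of "\<lambda>S. f (insert v S)"] insert.hyps
      by (simp add: bexp_insert algebra_simps)
  next
    case True
    define Y' where "Y' = Y - {v}"
    have Y: "Y = insert v Y'" "v \<notin> Y'" "Y' \<subseteq> V" "finite Y'"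
      using True insert finite_subset[of Y' V] by (auto simp: Y'_def)
    have 0: "bexp p V (\<lambda>Z. of_bool (Y \<subseteq> Z) * f Z) = bexp p V (\<lambda>Z. 0)"
      unfolding bexp_def using insert.hyps True by (intro sum.cong refl) auto
    have 1: "bexp p V (\<lambda>Z. of_bool (Y \<subseteq> insert v Z) * f (insert v Z))
        = bexp p V (\<lambda>Z. of_bool (Y' \<subseteq> Z) * f (insert v Z))"
      unfolding bexp_def using Y insert.hyps by (intro sum.cong refl) auto
    show ?thesis
      unfolding bexp_insert[OF insert.hyps] 0 1
      using insert.IH[OF Y(3), of "\<lambda>S. f (insert v S)"] insert.hyps Y
      by (simp add: algebra_simps)
  qed
qed

lemma bexp_half_compl:
  assumes "finite V"
  shows "bexp (1/2) V (\<lambda>S. f (V - S)) = bexp (1/2) V f"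
  using assms
  unfolding bexp_def
  by (intro sum.reindex_bij_witness[of _ "\<lambda>S. V - S" "\<lambda>S. V - S"])
     (auto simp: double_diff mult.commute)

section \<open>Spread families and a single random round\<close>

text \<open>Members are indexed and weighted because the sets shrink from round to round, so that
  different indices may come to carry the same set. The total weight may lie below 1, since indices
  are dropped on the way.\<close>

locale spread_family =
  fixes V :: "'a set" and X :: "'i set" and \<nu> :: "'i \<Rightarrow> real" and F :: "'i \<Rightarrow> 'a set" and \<rho> :: real
  assumes finite_V: "finite V"
    and finite_X: "finite X"
    and nonneg: "i \<in> X \<Longrightarrow> 0 \<le> \<nu> i"
    and subset_V: "i \<in> X \<Longrightarrow> F i \<subseteq> V"
    and spread: "T \<subseteq> V \<Longrightarrow> (\<Sum>i\<in>{i\<in>X. T \<subseteq> F i}. \<nu> i) \<le> \<rho> ^ card T"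
begin

lemma total_le_1: "sum \<nu> X \<le> 1"
  using spread[of "{}"] by simp

text \<open>Some member inside \<open>F i \<union> W\<close> leaves fewer than \<open>m\<close> points uncovered by \<open>W\<close>.\<close>
definition good :: "nat \<Rightarrow> 'a set \<Rightarrow> 'i \<Rightarrow> bool" where
  "good m W i \<longleftrightarrow> (\<exists>j\<in>X. F j \<subseteq> F i \<union> W \<and> card (F j - W) < m)"

text \<open>Sum over all \<open>T \<subseteq> F i\<close> with at least \<open>m\<close> points
  instead of the actual intersections. Spreadness bounds the share of each \<open>T\<close> by
  \<open>(\<rho> / p) ^ card T \<le> (1/1600) ^ m\<close>, and \<open>F i\<close> has at most
  \<open>4 ^ m\<close> subsets.\<close>

lemma pair_sum_le:
  assumes "i \<in> X" "card (F i) < 2 * m" "0 < p" "0 \<le> \<rho>" "1600 * \<rho> \<le> p"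
  shows "(\<Sum>j\<in>{j\<in>X. m \<le> card (F i \<inter> F j)}. \<nu> j * (1/p) ^ card (F i \<inter> F j)) \<le> (1/400) ^ m"
proof -
  have fin: "finite (F i)" using subset_V[OF assms(1)] finite_V finite_subset by blast
  let ?P = "{T \<in> Pow (F i). m \<le> card T}"
  let ?J = "{j\<in>X. m \<le> card (F i \<inter> F j)}"
  have "(\<Sum>j\<in>?J. \<nu> j * (1/p) ^ card (F i \<inter> F j))
      \<le> (\<Sum>j\<in>?J. \<Sum>T\<in>?P. of_bool (T \<subseteq> F j) * (\<nu> j * (1/p) ^ card T))"
  proof (rule sum_mono)
    fix j assume j: "j \<in> ?J"
    have "\<nu> j * (1/p) ^ card (F i \<inter> F j)
        = (\<Sum>T\<in>{F i \<inter> F j}. of_bool (T \<subseteq> F j) * (\<nu> j * (1/p) ^ card T))" by simp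
    also have "\<dots> \<le> (\<Sum>T\<in>?P. of_bool (T \<subseteq> F j) * (\<nu> j * (1/p) ^ card T))"
      using j fin nonneg[of j] assms by (intro sum_mono2) auto
    finally show "\<nu> j * (1/p) ^ card (F i \<inter> F j)
        \<le> (\<Sum>T\<in>?P. of_bool (T \<subseteq> F j) * (\<nu> j * (1/p) ^ card T))" .
  qed
  also have "\<dots> = (\<Sum>T\<in>?P. \<Sum>j\<in>?J. of_bool (T \<subseteq> F j) * (\<nu> j * (1/p) ^ card T))"
    by (rule sum.swap)
  also have "\<dots> \<le> (\<Sum>T\<in>?P. (1/1600) ^ m)"
  proof (rule sum_mono)
    fix T assume T: "T \<in> ?P"
    have "(\<Sum>j\<in>?J. of_bool (T \<subseteq> F j) * (\<nu> j * (1/p) ^ card T))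
        = (1/p) ^ card T * (\<Sum>j\<in>?J. if T \<subseteq> F j then \<nu> j else 0)"
      unfolding sum_distrib_left by (intro sum.cong) auto
    also have "(\<Sum>j\<in>?J. if T \<subseteq> F j then \<nu> j else 0) \<le> (\<Sum>j\<in>X. if T \<subseteq> F j then \<nu> j else 0)"
      using finite_X nonneg by (intro sum_mono2) auto
    also have "\<dots> = (\<Sum>j\<in>{j\<in>X. T \<subseteq> F j}. \<nu> j)"
      using finite_X by (simp add: sum.inter_filter)
    also have "\<dots> \<le> \<rho> ^ card T"
      using T subset_V[OF assms(1)] by (intro spread) auto
    finally have "(\<Sum>j\<in>?J. of_bool (T \<subseteq> F j) * (\<nu> j * (1/p) ^ card T)) \<le> (1/p) ^ card T * \<rho> ^ card T"
      using assms by (simp add: mult_left_mono)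
    also have "\<dots> = (\<rho> / p) ^ card T" by (simp add: power_divide)
    also have "\<dots> \<le> (1/1600) ^ card T"
      using assms by (intro power_mono) (auto simp: field_simps)
    also have "\<dots> \<le> (1/1600) ^ m"
      using T by (intro power_decreasing) auto
    finally show "(\<Sum>j\<in>?J. of_bool (T \<subseteq> F j) * (\<nu> j * (1/p) ^ card T)) \<le> (1/1600) ^ m" .
  qed
  also have "\<dots> = real (card ?P) * (1/1600) ^ m" by simp
  also have "\<dots> \<le> 4 ^ m * (1/1600) ^ m"
  proof (rule mult_right_mono)
    have "card ?P \<le> card (Pow (F i))"
      using fin by (intro card_mono) auto
    also have "\<dots> = 2 ^ card (F i)" using fin by (simp add: card_Pow)
    also have "\<dots> \<le> 2 ^ (2 * m)" using assms by (intro power_increasing) auto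
    also have "\<dots> = (4::nat) ^ m" by (simp add: power_mult)
    finally show "real (card ?P) \<le> 4 ^ m" by (metis of_nat_le_iff of_nat_numeral of_nat_power)
  qed simp
  also have "\<dots> = (1/400) ^ m" by (simp flip: power_mult_distrib)
  finally show ?thesis .
qed

text \<open>A second-moment argument. Planting \<open>F i\<close> into the random set bounds the
  failing mass by the mean of \<open>B\<close>; only pairs meeting in at least \<open>m\<close>
  points contribute to \<open>B Z ^ 2\<close>, and \<open>pair_sum_le\<close> bounds their expected
  weight by \<open>(1/400) ^ m\<close>.\<close>

lemma fragment:
  assumes size: "\<And>i. i \<in> X \<Longrightarrow> card (F i) < 2 * m"
    and p: "0 < p" "p \<le> 1" "0 \<le> \<rho>" "1600 * \<rho> \<le> p"
  shows "(\<Sum>i\<in>X. \<nu> i * bexp p V (\<lambda>W. of_bool (\<not> good m W i))) \<le> (1/20) ^ m"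
proof -
  define bad where "bad Z i \<longleftrightarrow> (\<forall>j\<in>X. F j \<subseteq> Z \<longrightarrow> m \<le> card (F i \<inter> F j))" for Z i
  \<comment> \<open>Inverse-probability weights: \<open>F i \<subseteq> Z\<close> has probability
    \<open>p ^ card (F i)\<close>, so its expected weight is \<open>\<nu> i\<close>.\<close>
  define \<alpha> where "\<alpha> i = \<nu> i * (1/p) ^ card (F i)" for i
  have \<alpha>: "0 \<le> \<alpha> i" if "i \<in> X" for i
    using nonneg[OF that] p by (simp add: \<alpha>_def)
  define B where "B Z = (\<Sum>i\<in>X. \<alpha> i * of_bool (F i \<subseteq> Z \<and> bad Z i))" for Z
  define Q where "Q Z = (\<Sum>i\<in>X. \<Sum>j\<in>{j\<in>X. m \<le> card (F i \<inter> F j)}.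
      \<alpha> i * \<alpha> j * of_bool (F i \<union> F j \<subseteq> Z))" for Z
  \<comment> \<open>Conditioned on \<open>Z = W \<union> F i\<close>, a bad outcome no longer depends on how \<open>W\<close> meets \<open>F i\<close>.\<close>
  have planted: "bexp p V (\<lambda>W. of_bool (\<not> good m W i))
      \<le> (1/p) ^ card (F i) * bexp p V (\<lambda>Z. of_bool (F i \<subseteq> Z \<and> bad Z i))" if i: "i \<in> X" for i
  proof -
    have "bexp p V (\<lambda>W. of_bool (\<not> good m W i)) \<le> bexp p V (\<lambda>W. of_bool (bad (W \<union> F i) i))"
    proof (rule bexp_mono)
      fix W assume "W \<subseteq> V"
      have "bad (W \<union> F i) i" if ng: "\<not> good m W i"
        unfolding bad_def
      proof (intro ballI impI)
        fix j assume j: "j \<in> X" "F j \<subseteq> W \<union> F i"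
        then have "m \<le> card (F j - W)" using ng unfolding good_def by (auto simp: not_less)
        also have "\<dots> \<le> card (F i \<inter> F j)"
          using j subset_V[OF j(1)] finite_V by (intro card_mono) (auto intro: finite_subset)
        finally show "m \<le> card (F i \<inter> F j)" .
      qed
      then show "of_bool (\<not> good m W i) \<le> (of_bool (bad (W \<union> F i) i) :: real)" by auto
    qed (use p in auto)
    also have "\<dots> = (1/p) ^ card (F i) * bexp p V (\<lambda>Z. of_bool (F i \<subseteq> Z) * of_bool (bad Z i))"
      using bexp_superset[OF finite_V subset_V[OF i], of p "\<lambda>Z. of_bool (bad Z i)"] p
      by (simp add: power_divide)
    finally show ?thesis by (simp only: of_bool_conj)
  qed
  \<comment> \<open>If \<open>F i\<close> is bad in \<open>Z\<close>, every member inside \<open>Z\<close> meets it in at least \<open>m\<close> points.\<close>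
  have sq: "B Z ^ 2 \<le> Q Z" for Z
  proof -
    have "B Z ^ 2 = (\<Sum>i\<in>X. \<Sum>j\<in>X. \<alpha> i * of_bool (F i \<subseteq> Z \<and> bad Z i) * (\<alpha> j * of_bool (F j \<subseteq> Z \<and> bad Z j)))"
      by (simp add: B_def power2_eq_square sum_product)
    also have "\<dots> \<le> (\<Sum>i\<in>X. \<Sum>j\<in>X. if m \<le> card (F i \<inter> F j) then \<alpha> i * \<alpha> j * of_bool (F i \<union> F j \<subseteq> Z) else 0)"
      using \<alpha> by (intro sum_mono) (auto simp: bad_def)
    also have "\<dots> = Q Z"
      unfolding Q_def by (simp only: sum.inter_filter[OF finite_X])
    finally show ?thesis .
  qed
  have EQ: "bexp p V Q \<le> (1/400) ^ m"
  proof -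
    have "bexp p V Q = (\<Sum>i\<in>X. \<Sum>j\<in>{j\<in>X. m \<le> card (F i \<inter> F j)}.
        \<alpha> i * \<alpha> j * bexp p V (\<lambda>Z. of_bool (F i \<union> F j \<subseteq> Z)))"
      unfolding Q_def by (simp only: bexp_sum bexp_cmult)
    also have "\<dots> = (\<Sum>i\<in>X. \<nu> i * (\<Sum>j\<in>{j\<in>X. m \<le> card (F i \<inter> F j)}. \<nu> j * (1/p) ^ card (F i \<inter> F j)))"
      unfolding sum_distrib_left
    proof (intro sum.cong refl)
      fix i j assume ij: "i \<in> X" "j \<in> {j\<in>X. m \<le> card (F i \<inter> F j)}"
      have fin: "finite (F i)" "finite (F j)"
        using ij subset_V finite_V finite_subset by (metis (no_types, lifting) mem_Collect_eq)+
      have "bexp p V (\<lambda>Z. of_bool (F i \<union> F j \<subseteq> Z)) = p ^ card (F i \<union> F j)"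
        using bexp_superset[OF finite_V, of "F i \<union> F j" p "\<lambda>_. 1"] subset_V ij finite_V by simp
      moreover have "card (F i) + card (F j) = card (F i \<union> F j) + card (F i \<inter> F j)"
        using card_Un_Int[OF fin] .
      then have "p ^ card (F i) * p ^ card (F j) = p ^ card (F i \<union> F j) * p ^ card (F i \<inter> F j)"
        by (simp flip: power_add)
      ultimately show "\<alpha> i * \<alpha> j * bexp p V (\<lambda>Z. of_bool (F i \<union> F j \<subseteq> Z))
          = \<nu> i * (\<nu> j * (1/p) ^ card (F i \<inter> F j))"
        using p by (simp add: \<alpha>_def field_simps power_divide)
    qed
    also have "\<dots> \<le> (\<Sum>i\<in>X. \<nu> i * (1/400) ^ m)"
      using pair_sum_le size p nonneg by (intro sum_mono mult_left_mono) auto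
    also have "\<dots> = sum \<nu> X * (1/400) ^ m" by (simp add: sum_distrib_right)
    also have "\<dots> \<le> (1/400) ^ m"
      using total_le_1 mult_right_mono[of "sum \<nu> X" 1 "(1/400)^m"] by simp
    finally show ?thesis .
  qed
  \<comment> \<open>Stands in for Cauchy-Schwarz; the scale \<open>(1/20) ^ m\<close> is the square
    root of the bound on the mean of \<open>Q\<close>.\<close>
  have amgm: "2 * B Z \<le> (1/20) ^ m + 20 ^ m * Q Z" for Z
  proof -
    have d: "(1/20::real) ^ m * 20 ^ m = 1" by (simp flip: power_mult_distrib)
    have "0 \<le> 20 ^ m * ((1/20) ^ m - B Z) ^ 2" by simp
    also have "\<dots> = (1/20) ^ m * ((1/20) ^ m * 20 ^ m) - 2 * B Z * ((1/20) ^ m * 20 ^ m) + 20 ^ m * (B Z) ^ 2"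
      by (simp add: power2_eq_square algebra_simps)
    finally have "0 \<le> (1/20) ^ m - 2 * B Z + 20 ^ m * (B Z) ^ 2"
      unfolding d by simp
    moreover have "20 ^ m * (B Z) ^ 2 \<le> 20 ^ m * Q Z"
      using sq[of Z] by (intro mult_left_mono) auto
    ultimately show ?thesis by linarith
  qed
  have "(\<Sum>i\<in>X. \<nu> i * bexp p V (\<lambda>W. of_bool (\<not> good m W i)))
      \<le> (\<Sum>i\<in>X. \<nu> i * ((1/p) ^ card (F i) * bexp p V (\<lambda>Z. of_bool (F i \<subseteq> Z \<and> bad Z i))))"
    using planted nonneg by (intro sum_mono mult_left_mono) auto
  also have "\<dots> = bexp p V B"
    unfolding B_def by (simp only: bexp_sum bexp_cmult \<alpha>_def mult.assoc)
  finally have "2 * (\<Sum>i\<in>X. \<nu> i * bexp p V (\<lambda>W. of_bool (\<not> good m W i))) \<le> bexp p V (\<lambda>Z. 2 * B Z)"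
    by (simp add: bexp_cmult)
  also have "\<dots> \<le> bexp p V (\<lambda>Z. (1/20) ^ m + 20 ^ m * Q Z)"
    using p amgm by (intro bexp_mono) auto
  also have "\<dots> = (1/20) ^ m + 20 ^ m * bexp p V Q"
    using finite_V by (simp add: bexp_add bexp_cmult)
  also have "\<dots> \<le> (1/20) ^ m + 20 ^ m * (1/400) ^ m"
    using EQ by (intro add_left_mono mult_left_mono) auto
  also have "\<dots> = 2 * (1/20) ^ m" by (simp flip: power_mult_distrib)
  finally show ?thesis by simp
qed

end

section \<open>Covering a member of a spread family by a random set\<close>

text \<open>Each of the \<open>L\<close> rounds adds a \<open>p\<close>-random set and passes to
  remainders under half the previous size bound, until they are empty. The mass lost is dominated by
  a geometric series with partial sums \<open>(1 - (1/2) ^ L) / 10\<close>.\<close>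

lemma spread_family_miss:
  assumes "spread_family V X \<nu> F \<rho>"
    and "\<And>i. i \<in> X \<Longrightarrow> card (F i) < 2 ^ L"
    and p: "0 < p" "p \<le> 1" "0 \<le> \<rho>" "1600 * \<rho> \<le> p"
  shows "bexp (1 - (1 - p) ^ L) V (\<lambda>S. of_bool (\<not> (\<exists>i\<in>X. F i \<subseteq> S)))
      \<le> 1 - sum \<nu> X + (1 - (1/2) ^ L) / 10"
  using assms(1,2)
proof (induction L arbitrary: X F)
  case 0
  interpret spread_family V X \<nu> F \<rho> by fact
  \<comment> \<open>Sizes below \<open>2 ^ 0\<close> force empty sets, so a miss requires
    \<open>X = {}\<close>, and then the bound equals 1.\<close>
  have "F i = {}" if "i \<in> X" for i
    using 0(2)[OF that] subset_V[OF that] finite_V finite_subset by fastforce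
  then show ?case
    using total_le_1 finite_V by (cases "X = {}") auto
next
  case (Suc L)
  interpret spread_family V X \<nu> F \<rho> by fact
  let ?m = "2 ^ L :: nat"
  let ?q = "1 - (1 - p) ^ L"
  define h where "h W i = (SOME j. j \<in> X \<and> F j \<subseteq> F i \<union> W \<and> card (F j - W) < ?m)" for W i
  have h: "h W i \<in> X" "F (h W i) \<subseteq> F i \<union> W" "card (F (h W i) - W) < ?m" if "good ?m W i" for W i
  proof -
    have "\<exists>j. j \<in> X \<and> F j \<subseteq> F i \<union> W \<and> card (F j - W) < ?m"
      using that unfolding good_def by blast
    from someI_ex[OF this] show "h W i \<in> X" "F (h W i) \<subseteq> F i \<union> W" "card (F (h W i) - W) < ?m"
      unfolding h_def by blast+
  qed
  define G where "G W i = F (h W i) - W" for W i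
  define Y where "Y W = {i\<in>X. good ?m W i}" for W
  have GF: "G W i \<subseteq> F i" if "i \<in> Y W" for W i
    using that h[of W i] by (auto simp: G_def Y_def)
  \<comment> \<open>The weight stays with \<open>i\<close> although the remainder comes from
    \<open>h W i\<close>. Since \<open>G W i \<subseteq> F i\<close>, whatever lies in the new set
    lies in the old one, and spreadness survives.\<close>
  have sub: "spread_family V (Y W) \<nu> (G W) \<rho>" for W
  proof
    show "finite V" "finite (Y W)" using finite_V finite_X by (auto simp: Y_def)
    show "0 \<le> \<nu> i" if "i \<in> Y W" for i using that nonneg by (auto simp: Y_def)
    show "G W i \<subseteq> V" if "i \<in> Y W" for i using that GF subset_V by (fastforce simp: Y_def)
    fix T assume T: "T \<subseteq> V"
    have "(\<Sum>i\<in>{i \<in> Y W. T \<subseteq> G W i}. \<nu> i) \<le> (\<Sum>i\<in>{i \<in> X. T \<subseteq> F i}. \<nu> i)"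
    proof (rule sum_mono2)
      show "{i \<in> Y W. T \<subseteq> G W i} \<subseteq> {i \<in> X. T \<subseteq> F i}"
        using GF[of _ W] by (fastforce simp: Y_def)
    qed (use finite_X nonneg in auto)
    also have "\<dots> \<le> \<rho> ^ card T" using T by (rule spread)
    finally show "(\<Sum>i\<in>{i \<in> Y W. T \<subseteq> G W i}. \<nu> i) \<le> \<rho> ^ card T" .
  qed
  have q: "0 \<le> ?q" "?q \<le> 1" using p by (auto intro: power_le_one)
  have mass: "sum \<nu> (Y W) = sum \<nu> X - (\<Sum>i\<in>X. \<nu> i * of_bool (\<not> good ?m W i))" for W
  proof -
    have "sum \<nu> (Y W) = (\<Sum>i\<in>X. if good ?m W i then \<nu> i else 0)"
      unfolding Y_def by (rule sum.inter_filter[OF finite_X])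
    also have "\<dots> = (\<Sum>i\<in>X. \<nu> i - \<nu> i * of_bool (\<not> good ?m W i))"
      by (intro sum.cong) auto
    finally show ?thesis by (simp add: sum_subtractf)
  qed
  have *: "bexp ?q V (\<lambda>S. of_bool (\<not> (\<exists>i\<in>X. F i \<subseteq> W \<union> S)))
      \<le> (1 - sum \<nu> X + (1 - (1/2) ^ L) / 10) + (\<Sum>i\<in>X. \<nu> i * of_bool (\<not> good ?m W i))" for W
  proof -
    have "bexp ?q V (\<lambda>S. of_bool (\<not> (\<exists>i\<in>X. F i \<subseteq> W \<union> S)))
        \<le> bexp ?q V (\<lambda>S. of_bool (\<not> (\<exists>i\<in>Y W. G W i \<subseteq> S)))"
    proof (rule bexp_mono[OF q])
      fix S
      \<comment> \<open>The member contained in \<open>W \<union> S\<close> is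
        \<open>F (h W i)\<close>, possibly other than \<open>F i\<close>.\<close>
      have "\<exists>i\<in>X. F i \<subseteq> W \<union> S" if "i \<in> Y W" "G W i \<subseteq> S" for i
        using that h[of W i] by (intro bexI[of _ "h W i"]) (auto simp: G_def Y_def)
      then show "of_bool (\<not> (\<exists>i\<in>X. F i \<subseteq> W \<union> S)) \<le> (of_bool (\<not> (\<exists>i\<in>Y W. G W i \<subseteq> S)) :: real)"
        by auto
    qed
    also have "\<dots> \<le> 1 - sum \<nu> (Y W) + (1 - (1/2) ^ L) / 10"
      using h by (intro Suc.IH[OF sub]) (auto simp: G_def Y_def)
    finally show ?thesis by (simp add: mass)
  qed
  have "bexp (1 - (1 - p) ^ Suc L) V (\<lambda>S. of_bool (\<not> (\<exists>i\<in>X. F i \<subseteq> S)))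
      = bexp p V (\<lambda>W. bexp ?q V (\<lambda>S. of_bool (\<not> (\<exists>i\<in>X. F i \<subseteq> W \<union> S))))"
    by (subst bexp_bexp_union[OF finite_V]) simp
  also have "\<dots> \<le> bexp p V (\<lambda>W. (1 - sum \<nu> X + (1 - (1/2) ^ L) / 10) + (\<Sum>i\<in>X. \<nu> i * of_bool (\<not> good ?m W i)))"
    using p * by (intro bexp_mono) auto
  also have "\<dots> = (1 - sum \<nu> X + (1 - (1/2) ^ L) / 10) + (\<Sum>i\<in>X. \<nu> i * bexp p V (\<lambda>W. of_bool (\<not> good ?m W i)))"
    by (simp only: bexp_add bexp_const[OF finite_V] bexp_sum bexp_cmult)
  also have "\<dots> \<le> (1 - sum \<nu> X + (1 - (1/2) ^ L) / 10) + (1/20) ^ ?m"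
    using Suc.prems p by (intro add_left_mono fragment) auto
  \<comment> \<open>Here \<open>L + 1 \<le> 2 ^ L\<close> is used. The resulting
    \<open>(1/20) * (1/2) ^ L\<close> is exactly the growth of the error term in one round.\<close>
  also have "(1/20::real) ^ ?m \<le> (1/20) ^ Suc L"
    by (intro power_decreasing) (auto simp: Suc_le_eq)
  also have "(1/20::real) ^ Suc L \<le> (1/20) * (1/2) ^ L"
    by (simp add: power_mono)
  finally show ?case by (simp add: field_simps)
qed

text \<open>The density of one round is chosen so that \<open>L\<close> rounds together have density
  exactly 1/2. Bernoulli's inequality gives \<open>p \<ge> 1 / (2 * L)\<close>, which makes room for
  \<open>1600 * \<rho> \<le> p\<close>.\<close>

lemma ex_bias:
  fixes \<rho> :: real
  assumes "L \<ge> 1" "0 \<le> \<rho>" "3200 * real L * \<rho> \<le> 1"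
  obtains p where "0 < p" "p \<le> 1" "1600 * \<rho> \<le> p" "(1 - p) ^ L = 1/2"
proof -
  define p where "p = 1 - root L (1/2)"
  have r: "root L (1/2) ^ L = 1/2" "0 \<le> root L (1/2)" "root L (1/2) < 1"
    using assms(1) by auto
  have "1/2 \<le> (1 - 1 / (2 * real L)) ^ L"
    using Bernoulli_inequality[of "- 1 / (2 * real L)" L] assms(1) by (simp add: field_simps)
  then have "root L (1/2) ^ L \<le> (1 - 1 / (2 * real L)) ^ L" using r by simp
  moreover have "0 \<le> 1 - 1 / (2 * real L)" using assms(1) by (simp add: field_simps)
  ultimately have "root L (1/2) \<le> 1 - 1 / (2 * real L)"
    using power_mono_iff[OF r(2), of "1 - 1 / (2 * real L)" L] assms(1) by linarith
  then have "1 / (2 * real L) \<le> p" by (simp add: p_def)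
  moreover have "1600 * \<rho> \<le> 1 / (2 * real L)"
    using assms by (simp add: field_simps)
  ultimately show ?thesis using that[of p] r by (auto simp: p_def)
qed

text \<open>A uniform random \<open>S\<close> and its complement are both uniform. Each family is
  missed with probability at most 1/5, half of it for the missing mass and half for the rounds, so
  by the union bound some \<open>S\<close> succeeds for the first family while \<open>V - S\<close>
  succeeds for the second.\<close>

lemma spread_families_disjoint_members:
  assumes "spread_family V X \<nu> F \<rho>" "spread_family V Y \<nu>' G \<rho>"
    and "\<And>i. i \<in> X \<Longrightarrow> card (F i) < 2 ^ L" "\<And>j. j \<in> Y \<Longrightarrow> card (G j) < 2 ^ L"
    and "sum \<nu> X \<ge> 9/10" "sum \<nu>' Y \<ge> 9/10"
    and "L \<ge> 1" "0 \<le> \<rho>" "3200 * real L * \<rho> \<le> 1"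
  obtains i j where "i \<in> X" "j \<in> Y" "F i \<inter> G j = {}"
proof -
  interpret spread_family V X \<nu> F \<rho> by fact
  obtain p where p: "0 < p" "p \<le> 1" "1600 * \<rho> \<le> p" "(1 - p) ^ L = 1/2"
    using ex_bias assms by metis
  define f :: "_ \<Rightarrow> real" where "f = (\<lambda>S. of_bool (\<not> (\<exists>i\<in>X. F i \<subseteq> S)))"
  define g :: "_ \<Rightarrow> real" where "g = (\<lambda>S. of_bool (\<not> (\<exists>j\<in>Y. G j \<subseteq> S)))"
  have half: "1 - (1 - p) ^ L = 1/2" using p(4) by simp
  have "(1 - (1/2) ^ L) / 10 \<le> (1/10 :: real)" by simp
  then have "bexp (1/2) V f \<le> 1/5" "bexp (1/2) V g \<le> 1/5"
    using spread_family_miss[OF assms(1,3) p(1,2) assms(8) p(3)] assms(5)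
      spread_family_miss[OF assms(2,4) p(1,2) assms(8) p(3)] assms(6)
    unfolding half f_def g_def by linarith+
  then have lt: "bexp (1/2) V (\<lambda>S. f S + g (V - S)) < 1"
    using bexp_half_compl[OF finite_V, of g] by (simp add: bexp_add)
  have "\<exists>S\<subseteq>V. f S + g (V - S) < 1"
  proof (rule ccontr)
    assume "\<not> ?thesis"
    then have "bexp (1/2) V (\<lambda>S. 1) \<le> bexp (1/2) V (\<lambda>S. f S + g (V - S))"
      by (intro bexp_mono) (auto simp: not_less)
    then show False using lt finite_V by simp
  qed
  then obtain S where "f S + g (V - S) < 1" by blast
  then have "f S = 0" "g (V - S) = 0" by (auto simp: f_def g_def of_bool_def split: if_splits)
  then show ?thesis using that by (fastforce simp: f_def g_def)
qed


section \<open>Restrictions of vector families and their graphs\<close>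

definition restr :: "(nat \<Rightarrow> nat) set \<Rightarrow> nat set \<Rightarrow> (nat \<Rightarrow> nat) \<Rightarrow> (nat \<Rightarrow> nat) set" where
  "restr A T a = {x\<in>A. \<forall>t\<in>T. x t = a t}"

text \<open>Agreement of two vectors at a coordinate becomes a common point of their graphs;
  \<open>D\<close> will be the set of coordinates left free.\<close>

definition graph_on :: "nat set \<Rightarrow> (nat \<Rightarrow> nat) \<Rightarrow> (nat \<times> nat) set" where
  "graph_on D x = (\<lambda>i. (i, x i)) ` D"

lemma card_graph_on_le: "finite D \<Longrightarrow> card (graph_on D x) \<le> card D"
  unfolding graph_on_def by (rule card_image_le)

lemma finite_cube: "finite (cube k n)"
  unfolding cube_def by (intro finite_PiE) auto

lemma card_restr_le:
  assumes "A \<subseteq> cube k n" "T \<subseteq> {0..<n}"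
  shows "card (restr A T a) \<le> k ^ (n - card T)"
proof -
  let ?D = "{0..<n} - T"
  have "inj_on (\<lambda>x. restrict x ?D) (restr A T a)"
  proof (rule inj_onI)
    fix x y assume xy: "x \<in> restr A T a" "y \<in> restr A T a" "restrict x ?D = restrict y ?D"
    have ext: "x \<in> {0..<n} \<rightarrow>\<^sub>E {0..<k}" "y \<in> {0..<n} \<rightarrow>\<^sub>E {0..<k}"
      using xy assms(1) by (auto simp: restr_def cube_def)
    show "x = y"
    proof
      fix i
      consider "i \<notin> {0..<n}" | "i \<in> T" | "i \<in> ?D" by blast
      then show "x i = y i"
      proof cases
        case 1 then show ?thesis using ext by (metis PiE_arb)
      next
        case 2 then show ?thesis using xy by (simp add: restr_def)
      next
        case 3 then show ?thesis using fun_cong[OF xy(3), of i] by simp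
      qed
    qed
  qed
  moreover have "(\<lambda>x. restrict x ?D) ` restr A T a \<subseteq> ?D \<rightarrow>\<^sub>E {0..<k}"
    using assms by (auto simp: restr_def cube_def PiE_iff subset_iff)
  ultimately have "card (restr A T a) \<le> card (?D \<rightarrow>\<^sub>E {0..<k})"
    by (intro card_inj_on_le finite_PiE) auto
  also have "\<dots> = k ^ (n - card T)"
    using assms(2) by (simp add: card_PiE card_Diff_subset finite_subset)
  finally show ?thesis .
qed

text \<open>Take \<open>T\<close> as large as possible such that some restriction still holds a
  \<open>\<rho> ^ card T\<close> share of \<open>A\<close>. If too many members contained
  \<open>U\<close>, fixing the coordinates of \<open>U\<close> as well would give a larger such
  set.\<close>

lemma ex_spread_restr:
  fixes \<rho> :: real
  assumes A: "A \<subseteq> cube k n" "A \<noteq> {}" and \<rho>: "0 < \<rho>"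
  obtains T a where "T \<subseteq> {0..<n}" "a \<in> A" "\<rho> ^ card T * real (card A) \<le> real (card (restr A T a))"
    "\<forall>U. real (card {x\<in>restr A T a. U \<subseteq> graph_on ({0..<n} - T) x})
        \<le> \<rho> ^ card U * real (card (restr A T a))"
proof -
  define P where "P m \<longleftrightarrow> (\<exists>T a. T \<subseteq> {0..<n} \<and> a \<in> A \<and> card T = m \<and>
      \<rho> ^ card T * real (card A) \<le> real (card (restr A T a)))" for m
  have finA: "finite A" using A finite_cube finite_subset by blast
  have "restr A {} a = A" for a by (simp add: restr_def)
  then have "P 0" unfolding P_def using A by (intro exI[of _ "{}"]) auto
  moreover have bound: "m \<le> n" if "P m" for m
    using that card_mono[of "{0..<n}"] unfolding P_def by fastforce
  ultimately obtain m where m: "P m" "\<And>m'. P m' \<Longrightarrow> m' \<le> m"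
    using GreatestI_nat[of P 0 n] Greatest_le_nat[of P _ n] by metis
  then obtain T a where Ta: "T \<subseteq> {0..<n}" "a \<in> A" "card T = m"
      "\<rho> ^ card T * real (card A) \<le> real (card (restr A T a))"
    unfolding P_def by blast
  have finT: "finite T" using Ta(1) finite_subset by blast
  have "real (card {x\<in>restr A T a. U \<subseteq> graph_on ({0..<n} - T) x}) \<le> \<rho> ^ card U * real (card (restr A T a))"
    (is "real (card ?S) \<le> _") for U
  proof (cases "U = {} \<or> ?S = {}")
    case True
    then show ?thesis
    proof
      assume "?S = {}"
      then have "real (card ?S) = 0" by (simp only: card.empty of_nat_0)
      then show ?thesis using \<rho> by simp
    qed simp
  next
    case False
    \<comment> \<open>As \<open>x0\<close> agrees with \<open>a\<close> on \<open>T\<close> and its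
      graph contains \<open>U\<close>, it alone describes the enlarged restriction.\<close>
    then obtain x0 where x0: "x0 \<in> A" "x0 \<in> restr A T a" "U \<subseteq> graph_on ({0..<n} - T) x0"
      by (auto simp: restr_def)
    let ?T = "T \<union> fst ` U"
    have inj: "inj_on fst U"
      using x0(3) by (rule inj_on_subset[rotated]) (auto simp: graph_on_def inj_on_def)
    have finU: "finite U" using x0(3) finite_subset by (fastforce simp: graph_on_def)
    have disj: "T \<inter> fst ` U = {}" and sub: "?T \<subseteq> {0..<n}"
      using x0(3) Ta(1) by (auto simp: graph_on_def)
    have cT: "card ?T = card T + card U"
      using finT finU disj inj by (simp add: card_Un_disjoint card_image)
    moreover have "card U > 0" using False finU by (simp add: card_gt_0_iff)
    ultimately have "\<not> P (card ?T)" using m(2)[of "card ?T"] Ta(3) by auto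
    then have "real (card (restr A ?T x0)) < \<rho> ^ card ?T * real (card A)"
      using sub x0(1) unfolding P_def by (metis not_le)
    moreover have "?S \<subseteq> restr A ?T x0"
      using x0 by (fastforce simp: restr_def graph_on_def subset_iff)
    then have "card ?S \<le> card (restr A ?T x0)"
      using finA by (intro card_mono) (auto simp: restr_def)
    ultimately have "real (card ?S) \<le> \<rho> ^ card ?T * real (card A)" by linarith
    also have "\<dots> = \<rho> ^ card U * (\<rho> ^ card T * real (card A))"
      by (simp add: cT power_add)
    also have "\<dots> \<le> \<rho> ^ card U * real (card (restr A T a))"
      using Ta(4) \<rho> by (intro mult_left_mono) auto
    finally show ?thesis .
  qed
  then show ?thesis using that Ta by blast
qed

section \<open>Moving a set of coordinates off itself\<close>

text \<open>A share \<open>1 / card D\<close> of \<open>G\<close> sends a given \<open>i\<close> to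
  a given \<open>j\<close>. Hence the share sending some point of \<open>T\<close> into
  \<open>T\<close> is at most \<open>card T ^ 2 / card D < 1\<close>.\<close>

lemma ex_disjoint_image:
  fixes G :: "('a \<Rightarrow> 'a) set"
  assumes fin: "finite D" "finite G" "G \<noteq> {}"
    and perm: "\<And>\<sigma>. \<sigma> \<in> G \<Longrightarrow> \<sigma> permutes D"
    and comp: "\<And>\<sigma> \<tau>. \<sigma> \<in> G \<Longrightarrow> \<tau> \<in> G \<Longrightarrow> \<tau> \<circ> \<sigma> \<in> G"
    and trans: "\<And>i j. i \<in> D \<Longrightarrow> j \<in> D \<Longrightarrow> \<exists>\<sigma>\<in>G. \<sigma> i = j"
    and T: "T \<subseteq> D" "card T * card T < card D"
  obtains \<sigma> where "\<sigma> \<in> G" "\<sigma> ` T \<inter> T = {}"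
proof -
  define c where "c i j = card {\<sigma>\<in>G. \<sigma> i = j}" for i j
  \<comment> \<open>Composition with some \<open>\<tau>\<close> taking \<open>j\<close> to
    \<open>j'\<close> injects one class into the other; exchanging \<open>j\<close> and
    \<open>j'\<close> gives equality.\<close>
  have le: "c i j \<le> c i j'" if "j \<in> D" "j' \<in> D" for i j j'
  proof -
    obtain \<tau> where \<tau>: "\<tau> \<in> G" "\<tau> j = j'" using trans \<open>j \<in> D\<close> \<open>j' \<in> D\<close> by blast
    have "inj \<tau>" using perm[OF \<tau>(1)] permutes_inj by blast
    then have "inj_on (\<lambda>\<sigma>. \<tau> \<circ> \<sigma>) {\<sigma>\<in>G. \<sigma> i = j}"
      using fun.inj_map inj_on_subset by blast
    then show ?thesis
      unfolding c_def using \<tau> comp fin by (intro card_inj_on_le) auto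
  qed
  have tot: "(\<Sum>j\<in>D. c i j) = card G" if "i \<in> D" for i
  proof -
    have "(\<Sum>j\<in>D. c i j) = card (\<Union>j\<in>D. {\<sigma>\<in>G. \<sigma> i = j})"
      unfolding c_def using fin by (intro card_UN_disjoint[symmetric]) auto
    also have "(\<Union>j\<in>D. {\<sigma>\<in>G. \<sigma> i = j}) = G"
      using that perm permutes_in_image by fastforce
    finally show ?thesis .
  qed
  have c: "card D * c i j = card G" if "i \<in> D" "j \<in> D" for i j
  proof -
    have "card D * c i j = (\<Sum>j'\<in>D. c i j')"
      using sum.cong[of D D "\<lambda>_. c i j" "c i"] le that by (simp add: antisym)
    then show ?thesis using tot that by simp
  qed
  show ?thesis
  proof (rule ccontr)
    assume no: "\<not> thesis"
    have "G \<subseteq> (\<Union>i\<in>T. \<Union>j\<in>T. {\<sigma>\<in>G. \<sigma> i = j})"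
      using that no by fastforce
    moreover have finT: "finite T" using T fin finite_subset by blast
    ultimately have "card G \<le> card (\<Union>i\<in>T. \<Union>j\<in>T. {\<sigma>\<in>G. \<sigma> i = j})"
      using fin by (intro card_mono) auto
    also have "\<dots> \<le> (\<Sum>i\<in>T. card (\<Union>j\<in>T. {\<sigma>\<in>G. \<sigma> i = j}))"
      using finT by (rule card_UN_le)
    also have "\<dots> \<le> (\<Sum>i\<in>T. \<Sum>j\<in>T. c i j)"
      unfolding c_def using finT by (intro sum_mono card_UN_le)
    finally have "card D * card G \<le> card D * (\<Sum>i\<in>T. \<Sum>j\<in>T. c i j)" by simp
    also have "\<dots> = (\<Sum>i\<in>T. \<Sum>j\<in>T. card G)"
      unfolding sum_distrib_left using c T by (intro sum.cong) auto
    also have "\<dots> = card T * card T * card G" by simp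
    finally have "card D \<le> card T * card T" using fin by (simp add: card_gt_0_iff)
    then show False using T by simp
  qed
qed

lemma transitive_symmetric_disjoint_image:
  assumes A: "transitive_symmetric n A" and T: "T \<subseteq> {0..<n}" "card T * card T < n"
  obtains \<sigma> where "\<sigma> permutes {0..<n}" "\<sigma> ` T \<inter> T = {}"
    "\<forall>x \<in> {0..<n} \<rightarrow>\<^sub>E (UNIV::nat set). x \<in> A \<longleftrightarrow> x \<circ> \<sigma> \<in> A"
proof -
  let ?E = "{0..<n} \<rightarrow>\<^sub>E (UNIV::nat set)"
  define G where "G = {\<sigma>. \<sigma> permutes {0..<n} \<and> (\<forall>x \<in> ?E. x \<in> A \<longleftrightarrow> x \<circ> \<sigma> \<in> A)}"
  \<comment> \<open>Invariance concerns extensional functions, so using it twice requires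
    \<open>x \<circ> \<tau>\<close> to be one; it is, because \<open>\<tau>\<close> fixes every
    point outside \<open>{0..<n}\<close>.\<close>
  have ext: "x \<circ> \<tau> \<in> ?E" if "\<tau> permutes {0..<n}" "x \<in> ?E" for \<tau> x
  proof -
    have "(x \<circ> \<tau>) i = undefined" if i: "i \<notin> {0..<n}" for i
      using \<open>x \<in> ?E\<close> permutes_not_in[OF \<open>\<tau> permutes {0..<n}\<close> i] PiE_arb[of x _ _ i] i by simp
    then show ?thesis by (simp add: PiE_iff extensional_def)
  qed
  have finG: "finite G"
    using finite_permutations[of "{0..<n}"] by (rule rev_finite_subset) (auto simp: G_def)
  have "id \<in> G" by (simp add: G_def permutes_id)
  then have neG: "G \<noteq> {}" by blast
  have comp: "\<tau> \<circ> \<sigma> \<in> G" if st: "\<sigma> \<in> G" "\<tau> \<in> G" for \<sigma> \<tau>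
  proof -
    have "x \<in> A \<longleftrightarrow> x \<circ> (\<tau> \<circ> \<sigma>) \<in> A" if x: "x \<in> ?E" for x
    proof -
      have "x \<in> A \<longleftrightarrow> x \<circ> \<tau> \<in> A" using st(2) x unfolding G_def by blast
      also have "\<dots> \<longleftrightarrow> (x \<circ> \<tau>) \<circ> \<sigma> \<in> A" using st ext[OF _ x] unfolding G_def by blast
      finally show ?thesis by (simp only: comp_assoc)
    qed
    then show ?thesis using st permutes_compose unfolding G_def by blast
  qed
  have trans: "\<exists>\<sigma>\<in>G. \<sigma> i = j" if "i \<in> {0..<n}" "j \<in> {0..<n}" for i j
    using A that unfolding transitive_symmetric_def G_def by blast
  have perm: "\<sigma> permutes {0..<n}" if "\<sigma> \<in> G" for \<sigma>
    using that by (simp add: G_def)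
  have "card T * card T < card {0..<n}" using T(2) by simp
  then obtain \<sigma> where "\<sigma> \<in> G" "\<sigma> ` T \<inter> T = {}"
    using ex_disjoint_image[OF finite_atLeastLessThan finG neG perm comp trans T(1)] by blast
  then show ?thesis using that unfolding G_def by blast
qed

section \<open>Density and logarithm estimates\<close>

text \<open>Each fixed coordinate shrinks the cube by the factor \<open>k\<close> but the family on
  average by at most \<open>k / 4\<close>. The density thus gains a factor 4 per coordinate, and it
  cannot exceed 1.\<close>

lemma spread_restr_density:
  fixes \<rho> :: real
  assumes T: "T \<subseteq> {0..<n}" and k: "k > 0" and \<rho>: "\<rho> = 4 / real k"
    and A: "A \<subseteq> cube k n" "\<rho> ^ card T * real (card A) \<le> real (card (restr A T a))"
  shows "4 ^ card T * (real (card A) / real k ^ n) \<le> 1"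
proof -
  have cT: "card T \<le> n" using card_mono[OF _ T] by simp
  have "\<rho> ^ card T * real (card A) \<le> real k ^ (n - card T)"
    using A(2) card_restr_le[OF A(1) T, of a] by (smt (verit) of_nat_le_iff of_nat_power)
  then have "real k ^ card T * (\<rho> ^ card T * real (card A)) \<le> real k ^ card T * real k ^ (n - card T)"
    by (intro mult_left_mono) auto
  then have "4 ^ card T * real (card A) \<le> real k ^ n"
    using k cT by (simp add: \<rho> power_divide flip: power_add)
  then show ?thesis using k by (simp add: field_simps)
qed

text \<open>The estimate \<open>exp x \<le> 1 + x + x^2\<close> is too weak at 2/3, so it is used at
  1/12 and raised to the eighth power.\<close>

lemma ln_two_ge: "2/3 \<le> ln (2::real)"
proof -
  have "exp (2/3::real) = exp (1/12) ^ 8" by (simp flip: exp_of_nat_mult)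
  also have "\<dots> \<le> (157/144) ^ 8"
    using exp_bound[of "1/12"] by (intro power_mono) (auto simp: power2_eq_square)
  also have "\<dots> \<le> 2" by (simp add: power_divide)
  finally show ?thesis by (subst ln_ge_iff) simp_all
qed

text \<open>\<open>L\<close> is the number of binary digits of \<open>n\<close>, hence a number of
  rounds that exhausts graphs of at most \<open>n\<close> points.\<close>

lemma ex_log_bound:
  assumes "n \<ge> 2"
  obtains L where "L \<ge> 1" "n < 2 ^ L" "real L \<le> 3 * ln (real n)"
proof -
  define L where "L = Suc (nat \<lfloor>log 2 (real n)\<rfloor>)"
  have l: "0 \<le> log 2 (real n)" using assms by simp
  have "log 2 (real n) < real L" using l unfolding L_def by linarith
  then have "real n < 2 ^ L"
    using assms by (simp add: log_less_iff powr_realpow)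
  then have "n < 2 ^ L" by (metis of_nat_less_iff of_nat_numeral of_nat_power)
  moreover have "real L \<le> log 2 (real n) + 1" using l unfolding L_def by linarith
  moreover have "log 2 (real n) \<le> 3/2 * ln (real n)"
  proof -
    have "ln (real n) * 1 \<le> ln (real n) * (3/2 * ln 2)"
      using assms ln_two_ge by (intro mult_left_mono) auto
    then show ?thesis using ln_two_ge by (simp add: log_def field_simps)
  qed
  moreover have "ln 2 \<le> ln (real n)" using assms by simp
  ultimately show ?thesis using that[of L] ln_two_ge by (auto simp: L_def)
qed

section \<open>From a dense family to two vectors that agree nowhere\<close>

text \<open>The parameter \<open>s\<close> merges both ranges of \<open>k\<close>: its bound by
  \<open>sqrt n\<close> makes \<open>T\<close> small enough to be moved off itself, its bound by
  \<open>k / ln n\<close> makes \<open>\<rho>\<close> small enough for the random covering.\<close>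

lemma vector_intersecting_density_le:
  fixes n k :: nat and A :: "(nat \<Rightarrow> nat) set" and s :: real
  assumes n: "n \<ge> 2"
    and A: "A \<subseteq> cube k n" "vector_intersecting n A" "transitive_symmetric n A"
    and s: "s \<le> real k / ln (real n)" "s \<le> sqrt (real n)"
  shows "real (card A) / real k ^ n \<le> 128 * exp (- (0.0001 * s))"
proof (rule ccontr)
  define \<mu> where "\<mu> = real (card A) / real k ^ n"
  assume "\<not> ?thesis"
  then have \<mu>: "\<mu> > 128 * exp (- (0.0001 * s))" by (simp add: \<mu>_def)
  have "card A \<le> k ^ n"
    using card_mono[OF finite_cube A(1)] by (auto simp: cube_def card_PiE)
  then have "real (card A) \<le> real k ^ n" by (metis of_nat_le_iff of_nat_power)
  then have "\<mu> \<le> 1" unfolding \<mu>_def by (auto simp: divide_le_eq_1 not_less)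
  \<comment> \<open>For smaller \<open>s\<close> the claim is trivial: 128 exceeds
    \<open>exp 4\<close>, so the right-hand side is above 1.\<close>
  have s_large: "s > 40000"
  proof (rule ccontr)
    assume "\<not> ?thesis"
    then have "exp (0.0001 * s) \<le> exp (4 * 1)" by simp
    also have "\<dots> = exp (1::real) ^ 4" by (simp flip: exp_of_nat_mult)
    also have "\<dots> \<le> 3 ^ 4" using exp_le by (intro power_mono) auto
    finally have "exp (0.0001 * s) \<le> 128" by simp
    moreover have "128 < \<mu> * exp (0.0001 * s)"
      using \<mu> by (simp add: exp_minus field_simps)
    moreover have "\<mu> * exp (0.0001 * s) \<le> 1 * exp (0.0001 * s)"
      using \<open>\<mu> \<le> 1\<close> by (intro mult_right_mono) auto
    ultimately show False by linarith
  qed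
  have "ln 2 \<le> ln (real n)" using n by simp
  then have lnn: "ln (real n) \<ge> 2/3" using ln_two_ge by linarith
  have k: "real k \<ge> s * ln (real n)" using s(1) lnn by (simp add: field_simps)
  then have k_large: "real k > 40000 * ln (real n)"
    using mult_strict_right_mono[OF s_large, of "ln (real n)"] lnn by linarith
  then have k_pos: "k > 0" using lnn by (cases k) auto
  have "A \<noteq> {}"
  proof
    assume "A = {}" then show False using \<mu> by (simp add: \<mu>_def not_less)
  qed
  define \<rho> where "\<rho> = 4 / real k"
  have \<rho>: "0 < \<rho>" using k_pos by (simp add: \<rho>_def)
  obtain T a where T: "T \<subseteq> {0..<n}" "a \<in> A"
      and dens: "\<rho> ^ card T * real (card A) \<le> real (card (restr A T a))"
      and spr: "\<forall>U. real (card {x\<in>restr A T a. U \<subseteq> graph_on ({0..<n} - T) x})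
        \<le> \<rho> ^ card U * real (card (restr A T a))"
    using ex_spread_restr[OF A(1) \<open>A \<noteq> {}\<close> \<rho>] .
  have finT: "finite T" using T(1) finite_subset by blast
  \<comment> \<open>\<open>4 ^ card T\<close> is at most \<open>1 / \<mu>\<close>, hence below
    \<open>exp (0.0001 * s)\<close>.\<close>
  have T_small: "real (card T) \<le> s / 10000"
  proof -
    have "exp (real (card T)) = exp 1 ^ card T" by (simp flip: exp_of_nat_mult)
    also have "\<dots> \<le> 4 ^ card T" using exp_le by (intro power_mono) auto
    also have "\<dots> \<le> exp (0.0001 * s)"
    proof -
      have "4 ^ card T * exp (- (0.0001 * s)) \<le> 4 ^ card T * \<mu>"
      proof (rule mult_left_mono)
        show "exp (- (0.0001 * s)) \<le> \<mu>"
          using \<mu> exp_gt_zero[of "- (0.0001 * s)"] by linarith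
      qed simp
      also have "\<dots> \<le> 1"
        unfolding \<mu>_def using T(1) k_pos \<rho>_def A(1) dens by (rule spread_restr_density)
      finally show ?thesis by (simp add: exp_minus field_simps)
    qed
    finally show ?thesis by simp
  qed
  have T_sq: "card T * card T < n"
  proof -
    have "real (card T) < sqrt (real n)" using T_small s(2) s_large by linarith
    then have "real (card T) ^ 2 < sqrt (real n) ^ 2" by (intro power_strict_mono) auto
    then have "real (card T * card T) < real n" by (simp add: power2_eq_square)
    then show ?thesis by (simp only: of_nat_less_iff)
  qed
  have T_\<rho>: "real (card T) * \<rho> \<le> 1/10"
  proof -
    have "s * (2/3) \<le> s * ln (real n)" using lnn s_large by (intro mult_left_mono) auto
    then have "real (card T) \<le> real k / 40" using T_small k s_large by linarith
    then show ?thesis using k_pos by (simp add: \<rho>_def field_simps)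
  qed
  obtain \<sigma> where \<sigma>: "\<sigma> permutes {0..<n}" "\<sigma> ` T \<inter> T = {}"
    and \<sigma>A: "\<forall>x \<in> {0..<n} \<rightarrow>\<^sub>E UNIV. x \<in> A \<longleftrightarrow> x \<circ> \<sigma> \<in> A"
    by (rule transitive_symmetric_disjoint_image[OF A(3) T(1) T_sq])
  have ext: "x \<in> {0..<n} \<rightarrow>\<^sub>E UNIV" if "x \<in> A" for x
    using that A(1) by (auto simp: cube_def)
  have \<sigma>n: "\<sigma> i \<in> {0..<n} \<longleftrightarrow> i \<in> {0..<n}" for i
    using permutes_in_image[OF \<sigma>(1)] .
  have inj\<sigma>: "inj \<sigma>" using \<sigma>(1) permutes_inj by blast
  define X where "X = restr A T a"
  define N where "N = real (card X)"
  define V where "V = {0..<n} \<times> {0..<k}"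
  define D1 where "D1 = {0..<n} - T"
  \<comment> \<open>The second family consists of the vectors \<open>x \<circ> \<sigma>\<close>,
    indexed by \<open>x \<in> X\<close>: they are fixed on the preimage of \<open>T\<close> and free
    on \<open>D2\<close>. \<open>X1\<close> and \<open>X2\<close> keep the vectors that avoid the
    values fixed in the other family.\<close>
  define D2 where "D2 = {i\<in>{0..<n}. \<sigma> i \<notin> T}"
  define X1 where "X1 = {x\<in>X. \<forall>j. \<sigma> j \<in> T \<longrightarrow> x j \<noteq> a (\<sigma> j)}"
  define X2 where "X2 = {x\<in>X. \<forall>j\<in>T. x (\<sigma> j) \<noteq> a j}"
  have finX: "finite X" using A(1) finite_cube finite_subset by (fastforce simp: X_def restr_def)
  have "a \<in> X" using T by (simp add: X_def restr_def)
  then have N: "N > 0" using finX by (auto simp: N_def card_gt_0_iff)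
  have spr': "real (card {x\<in>X. U \<subseteq> graph_on D1 x}) \<le> \<rho> ^ card U * N" for U
    using spr by (simp add: X_def N_def D1_def)
  have XA: "x \<in> A" if "x \<in> X" for x using that by (simp add: X_def restr_def)
  have xk: "x i < k" if "x \<in> A" "i < n" for x i
    using that A(1) PiE_mem[of x "{0..<n}" "\<lambda>_. {0..<k}" i] by (auto simp: cube_def)
  \<comment> \<open>Treats both families at once: spreadness is pulled back along an injective
    \<open>h\<close>, which is \<open>id\<close> for the first and applies \<open>\<sigma>\<close>
    to the coordinate for the second.\<close>
  have family: "spread_family V Y (\<lambda>_. 1 / N) F \<rho>"
    if Y: "Y \<subseteq> X" and FV: "\<And>x. x \<in> Y \<Longrightarrow> F x \<subseteq> V"
      and F: "\<And>x. x \<in> Y \<Longrightarrow> h ` F x \<subseteq> graph_on D1 x" and h: "inj h"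
    for Y F and h :: "nat \<times> nat \<Rightarrow> nat \<times> nat"
  proof
    fix U assume "U \<subseteq> V"
    have "{x\<in>Y. U \<subseteq> F x} \<subseteq> {x\<in>X. h ` U \<subseteq> graph_on D1 x}" using Y F by blast
    then have "card {x\<in>Y. U \<subseteq> F x} \<le> card {x\<in>X. h ` U \<subseteq> graph_on D1 x}"
      using finX by (intro card_mono) auto
    then have "real (card {x\<in>Y. U \<subseteq> F x}) \<le> \<rho> ^ card (h ` U) * N"
      using spr'[of "h ` U"] by linarith
    also have "card (h ` U) = card U"
      using h by (intro card_image) (auto simp: inj_on_def)
    finally show "(\<Sum>x\<in>{x\<in>Y. U \<subseteq> F x}. 1 / N) \<le> \<rho> ^ card U"
      using N by (simp add: field_simps)
  qed (use Y FV finX N finite_subset in \<open>auto simp: V_def\<close>)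
  \<comment> \<open>Every discarded vector has one of the points \<open>(f t, g t)\<close> in its
    graph, and each point lies in at most \<open>\<rho> * N\<close> graphs. \<open>T_\<rho>\<close>
    limits the total loss to a tenth.\<close>
  have mass: "(\<Sum>x\<in>Y. 1 / N) \<ge> 9/10"
    if Y: "Y \<subseteq> X" "\<And>x. x \<in> X \<Longrightarrow> x \<notin> Y \<Longrightarrow> \<exists>t\<in>T. x (f t) = g t"
      and f: "\<And>t. t \<in> T \<Longrightarrow> f t \<in> D1"
    for Y and f g :: "nat \<Rightarrow> nat"
  proof -
    have "X - Y \<subseteq> (\<Union>t\<in>T. {x\<in>X. {(f t, g t)} \<subseteq> graph_on D1 x})"
    proof
      fix x assume x: "x \<in> X - Y"
      then obtain t where t: "t \<in> T" "x (f t) = g t" using Y by blast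
      have "(f t, x (f t)) \<in> graph_on D1 x"
        unfolding graph_on_def using f[OF t(1)] by (rule imageI)
      then show "x \<in> (\<Union>t\<in>T. {x\<in>X. {(f t, g t)} \<subseteq> graph_on D1 x})"
        using x t by auto
    qed
    then have "card (X - Y) \<le> card (\<Union>t\<in>T. {x\<in>X. {(f t, g t)} \<subseteq> graph_on D1 x})"
      using finX finT by (intro card_mono) auto
    also have "\<dots> \<le> (\<Sum>t\<in>T. card {x\<in>X. {(f t, g t)} \<subseteq> graph_on D1 x})"
      using finT by (rule card_UN_le)
    finally have "real (card (X - Y)) \<le> (\<Sum>t\<in>T. real (card {x\<in>X. {(f t, g t)} \<subseteq> graph_on D1 x}))"
      by (simp only: of_nat_le_iff flip: of_nat_sum)
    also have "\<dots> \<le> (\<Sum>t\<in>T. \<rho> * N)"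
    proof (rule sum_mono)
      fix t
      show "real (card {x\<in>X. {(f t, g t)} \<subseteq> graph_on D1 x}) \<le> \<rho> * N"
        using spr'[of "{(f t, g t)}"] by simp
    qed
    also have "\<dots> = real (card T) * \<rho> * N" by simp
    also have "\<dots> \<le> 1/10 * N" using T_\<rho> N by (intro mult_right_mono) auto
    finally have "real (card (X - Y)) \<le> 1/10 * N" .
    moreover have "real (card (X - Y)) = N - real (card Y)"
      unfolding N_def using Y(1) finX card_mono[OF finX Y(1)] finite_subset[OF Y(1) finX]
      by (simp add: card_Diff_subset of_nat_diff)
    ultimately have "N - real (card Y) \<le> 1/10 * N" by simp
    then show ?thesis using N by (simp add: field_simps)
  qed
  obtain L where L: "L \<ge> 1" "n < 2 ^ L" "real L \<le> 3 * ln (real n)"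
    using ex_log_bound[OF n] .
  \<comment> \<open>The product \<open>3200 * 3 * 4 = 38400\<close> stays below the 40000 of
    \<open>k_large\<close>.\<close>
  have L\<rho>: "3200 * real L * \<rho> \<le> 1"
    using L(3) k_large lnn k_pos by (simp add: \<rho>_def field_simps)
  have D: "D1 \<subseteq> {0..<n}" "D2 \<subseteq> {0..<n}" by (auto simp: D1_def D2_def)
  have size: "card (graph_on D' x) < 2 ^ L" if "D' \<subseteq> {0..<n}" for D' x
    using card_graph_on_le[of D' x] card_mono[OF _ that] finite_subset[OF that] L(2) by simp
  have fam1: "spread_family V X1 (\<lambda>_. 1 / N) (graph_on D1) \<rho>"
    using D XA xk by (intro family[where h = id]) (auto simp: X1_def graph_on_def V_def)
  have fam2: "spread_family V X2 (\<lambda>_. 1 / N) (\<lambda>x. graph_on D2 (x \<circ> \<sigma>)) \<rho>"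
    using D XA xk inj\<sigma> \<sigma>n
    by (intro family[where h = "map_prod \<sigma> id"])
       (auto simp: X2_def graph_on_def V_def D1_def D2_def inj_def)
  have mass1: "(\<Sum>x\<in>X1. 1 / N) \<ge> 9/10"
  proof (rule mass[where f = "inv \<sigma>" and g = a])
    show "X1 \<subseteq> X" by (auto simp: X1_def)
    show "\<exists>t\<in>T. x (inv \<sigma> t) = a t" if "x \<in> X" "x \<notin> X1" for x
      using that inj\<sigma> by (force simp: X1_def)
    show "inv \<sigma> t \<in> D1" if "t \<in> T" for t
    proof -
      have "\<sigma> (inv \<sigma> t) = t" using \<sigma>(1) permutes_inverses(1) by metis
      then show ?thesis
        using that T(1) \<sigma>(2) \<sigma>n[of "inv \<sigma> t"] by (force simp: D1_def)
    qed
  qed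
  have mass2: "(\<Sum>x\<in>X2. 1 / N) \<ge> 9/10"
    using T(1) \<sigma>(2) \<sigma>n by (intro mass[where f = \<sigma> and g = a]) (auto simp: X2_def D1_def)
  obtain x y where xy: "x \<in> X1" "y \<in> X2" "graph_on D1 x \<inter> graph_on D2 (y \<circ> \<sigma>) = {}"
    by (rule spread_families_disjoint_members[OF fam1 fam2 size[OF D(1)] size[OF D(2)]
          mass1 mass2 L(1) less_imp_le[OF \<rho>] L\<rho>])
  have "x \<in> A" "y \<in> A"
    using xy XA by (auto simp: X1_def X2_def)
  moreover have "y \<circ> \<sigma> \<in> A"
    using bspec[OF \<sigma>A ext[OF \<open>y \<in> A\<close>]] \<open>y \<in> A\<close> by simp
  ultimately obtain i where i: "i \<in> {0..<n}" "x i = y (\<sigma> i)"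
    using A(2) unfolding vector_intersecting_def by fastforce
  \<comment> \<open>Agreement at \<open>i\<close> is excluded by \<open>X2\<close> if
    \<open>x i\<close> is fixed, by \<open>X1\<close> if \<open>y (\<sigma> i)\<close> is fixed, and
    by disjointness of the graphs if both are free.\<close>
  consider "i \<in> T" | "\<sigma> i \<in> T" | "i \<in> D1 \<inter> D2" using i by (auto simp: D1_def D2_def)
  then show False
  proof cases
    case 1
    then show ?thesis using xy i by (auto simp: X1_def X2_def X_def restr_def)
  next
    case 2
    then show ?thesis using xy i by (auto simp: X1_def X2_def X_def restr_def)
  next
    case 3
    then show ?thesis using xy(3) i by (auto simp: graph_on_def)
  qed
qed

theorem mainTheorem15:
  fixes n k :: nat and A :: "(nat \<Rightarrow> nat) set"
  assumes "n \<ge> 2"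
    and "A \<subseteq> cube k n"
    and "vector_intersecting n A"
    and "transitive_symmetric n A"
  shows "(2 * ln (real n) \<le> real k \<and> real k \<le> sqrt (real n) * ln (real n) \<longrightarrow>
           real (card A) / real k ^ n \<le> 128 * exp (- (0.0001 * real k / ln (real n))))
       \<and> (real k > sqrt (real n) * ln (real n) \<longrightarrow>
           real (card A) / real k ^ n \<le> 128 * exp (- (0.0001 * sqrt (real n))))"
proof -
  have pos: "ln (real n) > 0" using assms(1) by simp
  \<comment> \<open>In each range of \<open>k\<close>, \<open>s\<close> is the smaller of its two
    upper bounds.\<close>
  show ?thesis
  proof (intro conjI impI)
    assume "2 * ln (real n) \<le> real k \<and> real k \<le> sqrt (real n) * ln (real n)"
    then show "real (card A) / real k ^ n \<le> 128 * exp (- (0.0001 * real k / ln (real n)))"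
      using vector_intersecting_density_le[OF assms, of "real k / ln (real n)"] pos
      by (simp add: pos_divide_le_eq)
  next
    assume "real k > sqrt (real n) * ln (real n)"
    then show "real (card A) / real k ^ n \<le> 128 * exp (- (0.0001 * sqrt (real n)))"
      using vector_intersecting_density_le[OF assms, of "sqrt (real n)"] pos
      by (simp add: pos_le_divide_eq)
  qed
qed

end
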